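(* Let $G$ and $H$ be finite groups. If $P(G)\cong P(H)$ and $H$ is nilpotent, then $G$ is also nilpotent.
   Context: For a finite group $G$, the (undirected) power graph $P(G)$ is the graph with vertex set $G$ in which two vertices $a,b$ are adjacent if and only if $a\neq b$ and $a^m=b$ or $b^m=a$ for some positive integer $m$. The symbol $\cong$ between graphs denotes graph isomorphism. *)

theory Defs
  imports
    "HOL-Algebra.Algebra"
    "Graph_Theory.Pair_Digraph"
    "Graph_Theory.Digraph_Isomorphism"
begin

section \<open>Nilpotent groups\<close>

text \<open>Indices start at 0, so the entry at \<open>n\<close> is what is usually written
  \<open>\<gamma>\<^sub>n\<^sub>+\<^sub>1(G)\<close>. The commutator convention is that of \<^const>\<open>derived\<close>.\<close>

primrec lower_central_series :: "('a, 'm) monoid_scheme \<Rightarrow> nat \<Rightarrow> 'a set" where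
  "lower_central_series G 0 = carrier G"
| "lower_central_series G (Suc n) =
     generate G (\<Union>x \<in> lower_central_series G n. \<Union>y \<in> carrier G.
       { x \<otimes>\<^bsub>G\<^esub> y \<otimes>\<^bsub>G\<^esub> inv\<^bsub>G\<^esub> x \<otimes>\<^bsub>G\<^esub> inv\<^bsub>G\<^esub> y })"

definition nilpotent :: "('a, 'm) monoid_scheme \<Rightarrow> bool" where
  "nilpotent G \<longleftrightarrow> (\<exists>n. lower_central_series G n = {\<one>\<^bsub>G\<^esub>})"


section \<open>Power graphs\<close>

text \<open>As in the theory \<^theory>\<open>Graph_Theory.Digraph\<close>, an undirected simple graph is a symmetric
  loop-free digraph: each edge is represented by both of its orientations.\<close>

definition power_graph :: "('a, 'm) monoid_scheme \<Rightarrow> 'a pair_pre_digraph" where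
  "power_graph G =
     \<lparr> pverts = carrier G,
       parcs = {(a, b). a \<in> carrier G \<and> b \<in> carrier G \<and> a \<noteq> b \<and>
         (\<exists>m::nat. m > 0 \<and> (a [^]\<^bsub>G\<^esub> m = b \<or> b [^]\<^bsub>G\<^esub> m = a))} \<rparr>"

lemma graph_power_graph:
  assumes "finite (carrier G)"
  shows "graph (with_proj (power_graph G))"
proof -
  have "parcs (power_graph G) \<subseteq> carrier G \<times> carrier G"
    by (auto simp: power_graph_def)
  then have fin: "finite (parcs (power_graph G))"
    using assms finite_subset by blast
  show ?thesis
    by unfold_locales
       (use assms fin in \<open>auto simp: power_graph_def arc_to_ends_def symmetric_def sym_def\<close>)
qed

text \<open>On pair digraphs, \<^const>\<open>digraph_iso\<close> is isomorphism in the usual sense: a bijection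
  of the vertices that preserves and reflects adjacency.\<close>

lemma digraph_iso_with_proj_iff:
  assumes P: "parcs P \<subseteq> pverts P \<times> pverts P" and Q: "parcs Q \<subseteq> pverts Q \<times> pverts Q"
  shows "digraph_iso (with_proj P) (with_proj Q) \<longleftrightarrow>
    (\<exists>f. bij_betw f (pverts P) (pverts Q) \<and>
      (\<forall>a \<in> pverts P. \<forall>b \<in> pverts P. (a, b) \<in> parcs P \<longleftrightarrow> (f a, f b) \<in> parcs Q))"
    (is "?L \<longleftrightarrow> ?R")
proof
  assume ?L
  then obtain h where h: "pre_digraph.digraph_isomorphism (with_proj P) h"
    and Q_eq: "with_proj Q = app_iso h (with_proj P)"
    by (auto simp: digraph_iso_def)
  let ?f = "iso_verts h"
  have V: "pverts Q = ?f ` pverts P" and A: "parcs Q = iso_arcs h ` parcs P"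
    and t: "iso_tail h = fst" and d: "iso_head h = snd"
    using Q_eq by (auto simp: with_proj_def app_iso_def)
  have inj: "inj_on ?f (pverts P)"
    using h by (simp add: pre_digraph.digraph_isomorphism_def)
  have arc: "iso_arcs h e = (?f (fst e), ?f (snd e))" if "e \<in> parcs P" for e
    using h that t d by (auto simp: pre_digraph.digraph_isomorphism_def prod_eq_iff)
  have "(a, b) \<in> parcs P \<longleftrightarrow> (?f a, ?f b) \<in> parcs Q" if ab: "a \<in> pverts P" "b \<in> pverts P" for a b
  proof
    assume "(a, b) \<in> parcs P"
    then show "(?f a, ?f b) \<in> parcs Q" using arc A by force
  next
    assume "(?f a, ?f b) \<in> parcs Q"
    then obtain c e where ce: "(c, e) \<in> parcs P" "?f a = ?f c" "?f b = ?f e"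
      using arc A by force
    then show "(a, b) \<in> parcs P" using P ab inj by (auto dest: inj_onD)
  qed
  then show ?R using inj V by (auto simp: bij_betw_def)
next
  assume ?R
  then obtain f where f: "bij_betw f (pverts P) (pverts Q)"
    and adj: "\<And>a b. a \<in> pverts P \<Longrightarrow> b \<in> pverts P \<Longrightarrow> (a, b) \<in> parcs P \<longleftrightarrow> (f a, f b) \<in> parcs Q"
    by blast
  define h where "h = \<lparr>iso_verts = f, iso_arcs = map_prod f f, iso_head = snd, iso_tail = fst\<rparr>"
  have inj: "inj_on (map_prod f f) (parcs P)"
    using f P by (auto simp: bij_betw_def intro!: inj_on_subset[OF map_prod_inj_on])
  have wf: "wf_digraph (with_proj P)"
    using P by unfold_locales auto
  have "map_prod f f ` parcs P = parcs Q"
  proof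
    show "map_prod f f ` parcs P \<subseteq> parcs Q" using P adj by auto
    show "parcs Q \<subseteq> map_prod f f ` parcs P"
    proof
      fix e assume e: "e \<in> parcs Q"
      then have "e \<in> map_prod f f ` (pverts P \<times> pverts P)"
        using Q f map_prod_surj_on[of f "pverts P" "pverts Q" f "pverts P" "pverts Q"]
        by (auto simp: bij_betw_def)
      then show "e \<in> map_prod f f ` parcs P" using e adj by force
    qed
  qed
  then have "with_proj Q = app_iso h (with_proj P)"
    using f by (auto simp: with_proj_def app_iso_def h_def bij_betw_def)
  moreover have "pre_digraph.digraph_isomorphism (with_proj P) h"
    using f inj wf by (auto simp: pre_digraph.digraph_isomorphism_def h_def bij_betw_def)
  ultimately show ?L by (auto simp: digraph_iso_def)
qed

end

(* A finite group is nilpotent iff elements of prime power orders for distinct primes commute, and this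
   condition can be read off the power graph. If some nontrivial z is adjacent to everything in G, then
   elements of coprime orders cannot both lie above z, so they commute. Otherwise consider vertices with
   the same closed neighbourhood ("twins"). If y is a power of x and x, y are not twins, then x has at
   least as many twins as y, with equality only if ord x = 2 * ord y and ord y is odd; in that case the
   involution in <x> settles the direction. Hence a graph isomorphism f preserves, between non-twins,
   which of two adjacent vertices is a power of the other. The vertices that are twins or powers of x
   form the cyclic group generated by the twin of x of largest order, so that order is preserved, and f
   maps p-elements to p-elements. Finally x and y commute if f x and f y do: the product of f x and f y
   is adjacent to both, and so is its preimage to x and y. *)
theory Submission
  imports Defs "HOL-Number_Theory.Number_Theory"
begin

hide_const (open) Divisibility.prime

section \<open>Divisors and the totient function\<close>

text \<open>Take a prime \<open>p\<close> dividing \<open>N div M\<close>. The full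
  \<open>p\<close>-part of \<open>N\<close> cannot divide \<open>M\<close>, so \<open>M\<close>
  divides it. The cofactor \<open>m\<close> is coprime to \<open>p\<close> and comparable with
  \<open>M > 1\<close>, which leaves only \<open>m = 1\<close>.\<close>

lemma prime_power_if_divisors_comparable:
  fixes M N :: nat
  assumes MN: "M dvd N" "1 < M" "M < N"
    and cmp: "\<And>d. d dvd N \<Longrightarrow> d dvd M \<or> M dvd d"
  shows "\<exists>p k. prime p \<and> N = p ^ k"
proof -
  have "N div M \<noteq> 1" using MN by (auto elim!: dvdE)
  then obtain p where p: "prime p" "p dvd N div M" using prime_factor_nat by blast
  then have pM: "p * M dvd N"
    using MN by (metis dvd_div_iff_mult dvd_mult_div_cancel gr_implies_not0 mult.commute mult_dvd_mono dvd_refl)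
  define k where "k = multiplicity p N"
  have "N \<noteq> 0" "\<not> is_unit p" using MN p by auto
  then obtain m where m: "N = p ^ k * m" "\<not> p dvd m" unfolding k_def using multiplicity_decompose' by metis
  have co: "coprime p m" using m p by (simp add: prime_imp_coprime)
  have "\<not> p ^ k dvd M"
  proof
    assume "p ^ k dvd M"
    then have "p ^ Suc k dvd N" using pM by (metis dvd_trans mult_dvd_mono dvd_refl power_Suc)
    then show False using m p by simp
  qed
  then have M: "M dvd p ^ k" using cmp m by (metis dvd_triv_left)
  have "m dvd M \<or> M dvd m" using cmp m by simp
  then have "m = 1"
  proof
    assume "m dvd M"
    then have "m dvd p ^ k" using M dvd_trans by blast
    moreover have "coprime m (p ^ k)" using co by (simp add: ac_simps)
    ultimately show "m = 1" by (metis coprime_absorb_left nat_dvd_1_iff_1)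
  next
    assume "M dvd m"
    moreover have "coprime (p ^ k) m" using co by simp
    ultimately have "M = 1" using M by (metis coprime_common_divisor_nat)
    then show "m = 1" using MN by simp
  qed
  then show ?thesis using p m by auto
qed

text \<open>Multiplying \<open>M\<close> by a prime \<open>p\<close> multiplies its totient by
  \<open>p\<close> or \<open>p - 1\<close>, according to whether \<open>p\<close> divides
  \<open>M\<close>. The totient fails to grow only for \<open>p = 2\<close> and odd
  \<open>M\<close>, and a second factor 2 would double it.\<close>

lemma totient_eq_divisor:
  fixes M N :: nat
  assumes MN: "M dvd N" "M < N" and le: "totient N \<le> totient M"
  shows "N = 2 * M \<and> odd M"
proof -
  obtain k where k: "N = M * k" using MN by blast
  have M: "M > 0" and k1: "k > 1" using MN k by (cases k; auto)+
  have tM: "totient M > 0" using M by simp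
  have prime_dvd: "p = 2 \<and> odd M" if p: "prime p" "p dvd k" for p
  proof -
    have "p * M dvd N" using p k by (metis mult.commute mult_dvd_mono dvd_refl)
    then have le': "totient (p * M) \<le> totient M"
      using totient_dvd_mono[of "p * M" N] MN le by simp
    show ?thesis
    proof (cases "p dvd M")
      case True
      then have "totient (p * M) = p * totient M"
        using p totient_gt_0_iff[of p] prime_gt_0_nat[of p]
        by (simp add: totient_mult gcd_proj1_if_dvd del: totient_gt_0_iff)
      then show ?thesis using le' tM prime_gt_1_nat[OF p(1)] by simp
    next
      case False
      then have "coprime p M" using p prime_imp_coprime by blast
      then have "totient (p * M) = (p - 1) * totient M" using p by (simp add: totient_mult_coprime totient_prime)
      then have "p - 1 \<le> 1" using le' tM by simp
      then have "p = 2" using prime_ge_2_nat[OF p(1)] by simp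
      then show ?thesis using False by simp
    qed
  qed
  obtain p where "prime p" "p dvd k" using k1 prime_factor_nat[of k] by auto
  then have odd: "odd M" and "2 dvd k" using prime_dvd by auto
  then obtain j where j: "k = 2 * j" by blast
  have "j = 1"
  proof (rule ccontr)
    assume "j \<noteq> 1"
    then obtain q where q: "prime q" "q dvd j" using prime_factor_nat by blast
    then have "q = 2" using prime_dvd[of q] j by simp
    then have "2 dvd j" using q by simp
    then have "2 * (2 * M) dvd N" using j k by auto
    then have "totient (2 * (2 * M)) \<le> totient M"
      using totient_dvd_mono[of "2 * (2 * M)" N] MN le by simp
    moreover have "totient (2 * (2 * M)) = 2 * totient M"
      using odd totient_double[of "2 * M"] totient_double[of M] by simp
    ultimately show False using tM by linarith
  qed
  then show ?thesis using odd j k by simp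
qed

section \<open>Twins in the power graph\<close>

locale finite_group = group +
  assumes fin: "finite (carrier G)"

text \<open>In a finite group this is containment of cyclic subgroups. Exponent 0 adds nothing
  there, since the order of \<open>y\<close> is a positive exponent that also gives
  \<open>\<one>\<close>.\<close>

definition (in monoid) below :: "'a \<Rightarrow> 'a \<Rightarrow> bool" where
  "below x y \<longleftrightarrow> (\<exists>m::nat. y [^] m = x)"

text \<open>For finite groups this is adjacency or equality in the power graph; so \<open>twins\<close> below are
  the vertices with the same closed neighbourhood.\<close>

definition (in monoid) comparable :: "'a \<Rightarrow> 'a \<Rightarrow> bool" where
  "comparable x y \<longleftrightarrow> below x y \<or> below y x"

definition (in monoid) twins :: "'a \<Rightarrow> 'a set" where
  "twins x = {z \<in> carrier G. \<forall>w \<in> carrier G. comparable z w \<longleftrightarrow> comparable x w}"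

section \<open>Powers and orders inside a cyclic subgroup\<close>

context group
begin

lemma below_closed: "below x y \<Longrightarrow> y \<in> carrier G \<Longrightarrow> x \<in> carrier G"
  by (auto simp: below_def)

lemma below_refl: "x \<in> carrier G \<Longrightarrow> below x x"
  unfolding below_def by (metis nat_pow_eone)

lemma one_below: "below \<one> x"
  unfolding below_def by (metis nat_pow_0)

lemma below_trans: "below x y \<Longrightarrow> below y z \<Longrightarrow> z \<in> carrier G \<Longrightarrow> below x z"
  unfolding below_def by (metis nat_pow_pow)

lemma below_imp_ord_dvd:
  assumes "below x y" "y \<in> carrier G"
  shows "ord x dvd ord y"
proof -
  obtain m :: nat where m: "y [^] m = x" using assms by (auto simp: below_def)
  have "x [^] ord y = \<one>"
    using assms(2) m by (metis mult.commute nat_pow_one nat_pow_pow pow_ord_eq_1)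
  then show ?thesis using pow_eq_id below_closed assms by blast
qed

lemma nat_pow_cong:
  assumes "x \<in> carrier G" "[a = b] (mod ord x)"
  shows "x [^] a = x [^] b"
proof -
  have "[int b = int a] (mod int (ord x))" using assms(2) by (simp add: cong_int_iff cong_sym)
  then have "int (ord x) dvd int b - int a" by (simp add: cong_iff_dvd_diff)
  then show ?thesis using int_pow_eq[OF assms(1), of "int a" "int b"] by (simp add: int_pow_int)
qed

lemma commute_if_below:
  assumes "below x z" "below y z" "z \<in> carrier G"
  shows "x \<otimes> y = y \<otimes> x"
  using assms unfolding below_def by (auto simp: nat_pow_mult add.commute)

lemma comparable_sym: "comparable x y \<longleftrightarrow> comparable y x"
  by (auto simp: comparable_def)

end

context finite_group
begin

lemma ord_pos: "x \<in> carrier G \<Longrightarrow> ord x > 0"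
  using ord_ge_1[OF fin] by force

text \<open>A cyclic group has a single subgroup of each order. With \<open>g\<close> the gcd of
  \<open>j\<close> and \<open>ord z\<close>, the elements \<open>y\<close> and
  \<open>z [^] g\<close> are powers of each other, and \<open>ord x dvd ord y\<close> forces
  \<open>g\<close> to divide the exponent \<open>i\<close> of \<open>x\<close>.\<close>

lemma below_if_ord_dvd:
  assumes z: "z \<in> carrier G" and x: "below x z" and y: "below y z" and dvd: "ord x dvd ord y"
  shows "below x y"
proof -
  obtain i j :: nat where i: "x = z [^] i" and j: "y = z [^] j" using x y by (auto simp: below_def)
  define n where "n = ord z"
  define g where "g = gcd j n"
  have n: "n > 0" using ord_pos z n_def by simp
  then have g: "g > 0" "g dvd n" "g dvd j" by (auto simp: g_def)
  obtain k where k: "[j * k = g] (mod n)" using cong_solve_nat[of j n] unfolding g_def by blast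
  define w where "w = z [^] g"
  have w: "w \<in> carrier G" "ord w = n div g" using z g by (auto simp: w_def n_def ord_pow)
  have "w = y [^] k" using nat_pow_cong[OF z, of "j * k" g] k by (simp add: w_def j n_def z nat_pow_pow)
  then have wy: "below w y" by (auto simp: below_def)
  have "below y w" using g(3) by (auto simp: below_def w_def j z nat_pow_pow)
  then have "ord y = ord w" using wy w(1) below_imp_ord_dvd j z by (simp add: dvd_antisym)
  then have "x [^] (n div g) = \<one>" using dvd w below_closed[OF x z] pow_eq_id by simp
  then have "z [^] (i * (n div g)) = \<one>" by (simp add: i z nat_pow_pow)
  then have "n dvd i * (n div g)" using pow_eq_id[OF z] n_def by blast
  then have "g * (n div g) dvd i * (n div g)" using g by simp
  then have "g dvd i" using n g by (metis dvd_div_eq_0_iff dvd_times_right_cancel_iff gr_implies_not0)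
  then have "below x w" by (auto simp: below_def w_def i z nat_pow_pow)
  then show ?thesis using below_trans wy j z by blast
qed

lemma below_antisym_ord:
  "y \<in> carrier G \<Longrightarrow> below x y \<Longrightarrow> ord x = ord y \<Longrightarrow> below y x"
  by (metis below_if_ord_dvd below_refl dvd_refl)

lemma below_of_ord:
  assumes "z \<in> carrier G" "d dvd ord z"
  obtains x where "below x z" "ord x = d"
proof
  have "ord z div d \<noteq> 0" using assms ord_pos by (metis dvd_div_eq_0_iff less_not_refl)
  moreover have "ord z div d dvd ord z" using assms(2) by (metis dvd_def dvd_mult_div_cancel mult.commute)
  moreover have "ord z div (ord z div d) = d"
    using assms ord_pos[of z] by (auto elim!: dvdE)
  ultimately show "ord (z [^] (ord z div d)) = d" using assms(1) ord_pow by simp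
qed (auto simp: below_def)

lemma below_as_image:
  assumes "z \<in> carrier G"
  shows "{w. below w z} = (\<lambda>k. z [^] k) ` {1..ord z}"
proof -
  have "\<exists>k\<in>{1..ord z}. z [^] m = z [^] k" for m :: nat
  proof -
    \<comment> \<open>Exponents run from 1, the range of \<open>ord_inj'\<close>, so residue 0 is
      represented by \<open>ord z\<close>.\<close>
    define k where "k = (if m mod ord z = 0 then ord z else m mod ord z)"
    have "[m = k] (mod ord z)" unfolding k_def cong_def by (cases "m mod ord z = 0") simp_all
    moreover have "k \<in> {1..ord z}"
      using ord_pos[OF assms] mod_less_divisor[OF ord_pos[OF assms], of m] by (simp add: k_def)
    ultimately show ?thesis using nat_pow_cong assms by blast
  qed
  then show ?thesis by (auto simp: below_def)
qed

lemma card_below: "z \<in> carrier G \<Longrightarrow> card {w. below w z} = ord z"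
  using ord_inj' by (simp add: below_as_image card_image)

lemma finite_below: "z \<in> carrier G \<Longrightarrow> finite {w. below w z}"
  by (simp add: below_as_image)

text \<open>\<open>z [^] k\<close> generates the same subgroup as \<open>z\<close> exactly when
  \<open>k\<close> is invertible modulo \<open>ord z\<close>; the totatives index these generators
  without repetition.\<close>

lemma card_generators:
  assumes z: "z \<in> carrier G"
  shows "card {w. below w z \<and> below z w} = totient (ord z)"
proof -
  have "below z (z [^] k) \<longleftrightarrow> coprime k (ord z)" for k :: nat
  proof
    assume "below z (z [^] k)"
    then obtain m where "z [^] (k * m) = z [^] (1::nat)" by (auto simp: below_def z nat_pow_pow)
    then have "int (ord z) dvd int (k * m) - 1"
      using int_pow_eq[OF z, of 1 "int (k * m)"] by (metis int_pow_int of_nat_1)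
    then have "[int k * int m = 1] (mod int (ord z))" by (simp add: cong_iff_dvd_diff)
    then have "coprime (int k) (int (ord z))" using coprime_iff_invertible_int by blast
    then show "coprime k (ord z)" by simp
  next
    assume "coprime k (ord z)"
    then obtain m where "[k * m = 1] (mod ord z)" using coprime_iff_invertible_nat by auto
    then have "(z [^] k) [^] m = z" using nat_pow_cong[OF z, of "k*m" 1] z by (simp add: nat_pow_pow)
    then show "below z (z [^] k)" by (auto simp: below_def)
  qed
  then have "{w. below w z \<and> below z w} = (\<lambda>k. z [^] k) ` totatives (ord z)"
    using below_as_image[OF z] by (auto simp: set_eq_iff in_totatives_iff Suc_le_eq)
  moreover have "inj_on (\<lambda>k. z [^] k) (totatives (ord z))"
    using ord_inj'[OF z]
    by (rule inj_on_subset) (auto simp: in_totatives_iff)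
  ultimately show ?thesis by (simp add: card_image totient_def)
qed


section \<open>Classes of twins and their largest elements\<close>

lemma twins_refl: "x \<in> carrier G \<Longrightarrow> x \<in> twins x"
  by (simp add: twins_def)

lemma twins_eq: "y \<in> twins x \<Longrightarrow> twins y = twins x"
  by (auto simp: twins_def)

lemma twins_closed: "y \<in> twins x \<Longrightarrow> y \<in> carrier G"
  by (simp add: twins_def)

lemma finite_twins: "finite (twins x)"
  using fin by (simp add: twins_def)

lemma comparable_twin:
  "y \<in> twins x \<Longrightarrow> w \<in> carrier G \<Longrightarrow> comparable y w \<longleftrightarrow> comparable x w"
  by (simp add: twins_def)

lemma twins_comparable:
  assumes "y \<in> twins x" "z \<in> twins x" shows "comparable y z"
proof -
  have "comparable z z" using assms(2) by (simp add: comparable_def below_refl twins_closed)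
  then show ?thesis using assms by (simp add: twins_def)
qed

lemma generator_twin:
  "x \<in> carrier G \<Longrightarrow> below w x \<Longrightarrow> below x w \<Longrightarrow> w \<in> twins x"
  unfolding twins_def comparable_def using below_trans below_closed by blast

lemma totient_le_card_twins:
  assumes "x \<in> carrier G"
  shows "totient (ord x) \<le> card (twins x)"
proof -
  have "{w. below w x \<and> below x w} \<subseteq> twins x" using generator_twin assms by blast
  then show ?thesis using card_mono[OF finite_twins] card_generators[OF assms] by metis
qed

text \<open>Whatever lies below \<open>x\<close> is comparable with \<open>x\<close>, hence with its
  twin \<open>y\<close>. So every divisor of \<open>ord x\<close> divides \<open>ord y\<close> or is
  a multiple of it, as \<open>prime_power_if_divisors_comparable\<close> demands.\<close>

lemma twins_prime_power:
  assumes x: "x \<in> carrier G" and y: "y \<in> twins x" "below y x" "ord y < ord x" "y \<noteq> \<one>"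
  shows "\<exists>p k. prime p \<and> ord x = p ^ k"
proof (rule prime_power_if_divisors_comparable)
  have yG: "y \<in> carrier G" using y twins_closed by blast
  show "ord y dvd ord x" using x y below_imp_ord_dvd by blast
  show "1 < ord y" using ord_pos[OF yG] ord_eq_1[OF yG] y by linarith
  show "ord y < ord x" using y by simp
  fix d assume "d dvd ord x"
  then obtain z where z: "below z x" "ord z = d" using below_of_ord x by blast
  have zG: "z \<in> carrier G" using z x below_closed by blast
  have "comparable y z" using z zG comparable_twin[OF y(1)] by (simp add: comparable_def)
  then show "d dvd ord y \<or> ord y dvd d"
    using z zG yG below_imp_ord_dvd unfolding comparable_def by blast
qed

text \<open>The subgroups of a cyclic group of prime power order form a chain.\<close>

lemma below_prime_power_comparable:
  assumes "z \<in> carrier G" "prime p" "ord z = p ^ k" "below x z" "below y z"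
  shows "comparable x y"
proof -
  have "ord x dvd p ^ k" "ord y dvd p ^ k" using assms below_imp_ord_dvd by metis+
  then have "\<exists>i\<le>k. ord x = p ^ i" "\<exists>j\<le>k. ord y = p ^ j"
    using assms(2) by (simp_all add: divides_primepow_nat)
  then obtain i j where "ord x = p ^ i" "ord y = p ^ j" by blast
  then have "ord x dvd ord y \<or> ord y dvd ord x" using le_imp_power_dvd linear[of i j] by auto
  then show ?thesis unfolding comparable_def
    using below_if_ord_dvd[OF assms(1,4,5)] below_if_ord_dvd[OF assms(1,5,4)] by blast
qed

text \<open>If \<open>x\<close> and \<open>z\<close> have equal order, all three elements generate
  the same subgroup. Otherwise \<open>ord z\<close> is a prime power, so everything below
  \<open>z\<close> is comparable with \<open>y\<close>; the remaining comparisons follow by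
  transitivity through \<open>x\<close> or \<open>z\<close>.\<close>

lemma twins_convex:
  assumes x: "x \<in> carrier G" "x \<noteq> \<one>" and z: "z \<in> twins x" and y: "below x y" "below y z"
  shows "y \<in> twins x"
proof (cases "ord x = ord z")
  case True
  have zG: "z \<in> carrier G" using z twins_closed by blast
  have xz: "below x z" using y zG below_trans by blast
  then have "below z x" using True below_antisym_ord zG by blast
  then have "y \<in> twins z" using generator_twin zG y below_trans below_closed by blast
  then show ?thesis using z twins_eq by blast
next
  case False
  have zG: "z \<in> carrier G" using z twins_closed by blast
  have xz: "below x z" using y zG below_trans by blast
  then have "ord x < ord z"
    using False below_imp_ord_dvd zG ord_pos dvd_imp_le le_neq_implies_less by metis
  moreover have "x \<in> twins z" using z twins_eq twins_refl x by blast
  ultimately obtain p k where p: "prime p" "ord z = p ^ k" using twins_prime_power zG xz x by blast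
  have yG: "y \<in> carrier G" using y zG below_closed by blast
  have "comparable y w \<longleftrightarrow> comparable x w" if w: "w \<in> carrier G" for w
  proof
    assume "comparable y w"
    then consider "below w y" | "below y w" unfolding comparable_def by blast
    then show "comparable x w"
    proof cases
      case 1
      then have "comparable z w" using y zG below_trans unfolding comparable_def by blast
      then show ?thesis using comparable_twin z w by blast
    next
      case 2
      then show ?thesis using y w below_trans unfolding comparable_def by blast
    qed
  next
    assume c: "comparable x w"
    then have "comparable z w" using comparable_twin z w by blast
    then consider "below w z" | "below z w" unfolding comparable_def by blast
    then show "comparable y w"
    proof cases
      case 1
      then show ?thesis using below_prime_power_comparable[OF zG p] y by blast
    next
      case 2
      then show ?thesis using y w below_trans unfolding comparable_def by blast
    qed
  qed
  then show ?thesis using yG by (simp add: twins_def)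
qed

text \<open>Twins are pairwise comparable, so a twin of largest order lies above all the
  others.\<close>

lemma twins_top:
  assumes "x \<in> carrier G"
  obtains t where "t \<in> twins x" "\<And>z. z \<in> twins x \<Longrightarrow> below z t"
proof -
  have ne: "twins x \<noteq> {}" using assms twins_refl by blast
  define m where "m = Max (ord ` twins x)"
  have "m \<in> ord ` twins x" unfolding m_def using ne finite_twins by (intro Max_in) auto
  then obtain t where t: "t \<in> twins x" "ord t = m" by blast
  have "below z t" if z: "z \<in> twins x" for z
  proof (rule ccontr)
    assume nz: "\<not> below z t"
    then have tz: "below t z" using twins_comparable[OF z t(1)] unfolding comparable_def by blast
    have zG: "z \<in> carrier G" using z twins_closed by blast
    have "ord z \<le> ord t" unfolding t m_def using z finite_twins by (intro Max_ge) auto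
    moreover have "ord t \<le> ord z" using tz zG below_imp_ord_dvd ord_pos dvd_imp_le by blast
    ultimately show False using below_antisym_ord zG tz nz by simp
  qed
  then show ?thesis using that t by blast
qed

text \<open>An element below \<open>t\<close> is comparable with \<open>x\<close>; if it is above
  \<open>x\<close>, it lies between two twins and \<open>twins_convex\<close> applies. The left side
  can be followed through a graph isomorphism, while the right side has \<open>ord t\<close>
  elements.\<close>

lemma twins_or_below_eq:
  assumes x: "x \<in> carrier G" "x \<noteq> \<one>" and t: "t \<in> twins x" "\<And>z. z \<in> twins x \<Longrightarrow> below z t"
  shows "{z. z \<in> twins x \<or> below z x} = {z. below z t}"
proof -
  have tG: "t \<in> carrier G" using t twins_closed by blast
  have xt: "below x t" using t x twins_refl by blast
  have "z \<in> twins x \<or> below z x" if z: "below z t" for z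
  proof -
    have zG: "z \<in> carrier G" using z tG below_closed by blast
    have "comparable x z" using comparable_twin[OF t(1) zG] z by (simp add: comparable_def)
    then show ?thesis using twins_convex[OF x t(1)] z unfolding comparable_def by blast
  qed
  then show ?thesis using t xt below_trans tG by blast
qed

end

section \<open>Sizes of twin classes when only the identity is comparable with everything\<close>

locale reduced_group = finite_group +
  assumes dominating: "x \<in> carrier G \<Longrightarrow> (\<And>y. y \<in> carrier G \<Longrightarrow> comparable x y) \<Longrightarrow> x = \<one>"
begin

lemma one_not_twin:
  assumes "x \<in> carrier G" "x \<noteq> \<one>" shows "\<one> \<notin> twins x"
proof
  assume "\<one> \<in> twins x"
  then have "comparable x y" if "y \<in> carrier G" for y
    using comparable_twin[of \<one> x y] that by (simp add: comparable_def one_below)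
  then show False using dominating assms by blast
qed

text \<open>Let \<open>t\<close> be the top twin of \<open>v\<close>. If all twins of
  \<open>v\<close> have order \<open>ord t\<close>, they generate the same subgroup as
  \<open>t\<close> and number at most \<open>totient (ord t)\<close>;
  \<open>totient_eq_divisor\<close> then settles equality. If the orders differ,
  \<open>ord u\<close> is a prime power, and counting the elements below \<open>t\<close> gives a
  strict inequality.\<close>

lemma card_twins_above:
  assumes u: "u \<in> carrier G" "below v u" "v \<noteq> \<one>" "u \<notin> twins v"
  shows "card (twins v) \<le> card (twins u)"
    and "card (twins u) \<le> card (twins v) \<Longrightarrow> ord u = 2 * ord v \<and> odd (ord v)"
proof -
  have v: "v \<in> carrier G" using u below_closed by blast
  obtain t where t: "t \<in> twins v" and top: "\<And>z. z \<in> twins v \<Longrightarrow> below z t"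
    using twins_top[OF v] by blast
  have tG: "t \<in> carrier G" using t twins_closed by blast
  have "comparable t u" using comparable_twin[OF t u(1)] u(2) by (simp add: comparable_def)
  \<comment> \<open>Otherwise \<open>u\<close> would lie between \<open>v\<close> and its twin
    \<open>t\<close>, and be a twin of \<open>v\<close> itself.\<close>
  then have tu: "below t u" using twins_convex[OF v u(3) t u(2)] u(4) unfolding comparable_def by blast
  have ord_tu: "ord t dvd ord u" using below_imp_ord_dvd tu u by blast
  have "ord t \<noteq> ord u"
    using below_antisym_ord[OF u(1) tu] generator_twin[OF tG] tu u(4) twins_eq[OF t] by metis
  then have lt: "ord t < ord u" using ord_tu ord_pos[OF u(1)] dvd_imp_le le_neq_implies_less by metis
  have "card (twins v) < card (twins u) \<or> ord v = ord t \<and> card (twins v) \<le> totient (ord t)"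
  proof (cases "\<forall>w \<in> twins v. ord w = ord t")
    case True
    then have "twins v \<subseteq> {w. below w t \<and> below t w}" using top below_antisym_ord[OF tG] by blast
    moreover have "finite {w. below w t \<and> below t w}"
      using finite_below[OF tG] by (rule finite_subset[rotated]) blast
    ultimately show ?thesis using True card_mono card_generators[OF tG] v twins_refl by metis
  next
    case False
    then obtain w where w: "w \<in> twins v" "ord w \<noteq> ord t" by blast
    have wt: "below w t" using top w by blast
    have wlt: "ord w < ord t"
      using below_imp_ord_dvd[OF wt tG] ord_pos[OF tG] w(2) dvd_imp_le le_neq_implies_less by metis
    have w1: "w \<noteq> \<one>" using one_not_twin w v u by blast
    have wT: "w \<in> twins t" using w t twins_eq by blast
    obtain p s where p: "prime p" "ord t = p ^ s" using twins_prime_power[OF tG wT wt wlt w1] by blast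
    have wu: "below w u" using wt tu u below_trans by blast
    \<comment> \<open>Elements above \<open>t\<close> have \<open>p\<close>-power order: an element of order \<open>p ^ b * m\<close> below \<open>u\<close> is
      comparable with \<open>w\<close>, hence with its twin \<open>t\<close>.\<close>
    define a where "a = multiplicity p (ord u)"
    have "ord u \<noteq> 0" "\<not> is_unit p" using ord_pos u p by auto
    then obtain m where m: "ord u = p ^ a * m" "\<not> p dvd m" unfolding a_def
      using multiplicity_decompose' by metis
    have co: "coprime p m" using m p by (simp add: prime_imp_coprime)
    obtain b where b: "ord w = p ^ b" using below_imp_ord_dvd[OF wt tG] p divides_primepow_nat by metis
    have "p ^ b dvd ord u" using below_imp_ord_dvd[OF wu u(1)] b by simp
    moreover have "coprime (p ^ b) m" using co by simp
    ultimately have bm: "p ^ b * m dvd ord u" using m divides_mult by (metis dvd_triv_right)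
    then obtain z where z: "below z u" "ord z = p ^ b * m" using below_of_ord u by blast
    have zG: "z \<in> carrier G" using z u below_closed by blast
    have "below w z" using below_if_ord_dvd[OF u(1) wu z(1)] z b by simp
    then have "comparable t z" using comparable_twin[OF wT zG] by (simp add: comparable_def)
    then have "m = 1" unfolding comparable_def
    proof
      assume "below t z"
      then have "p ^ s dvd p ^ b * m" using below_imp_ord_dvd zG z p by metis
      moreover have "coprime (p ^ s) m" using co by simp
      ultimately have "p ^ s dvd p ^ b" using coprime_dvd_mult_left_iff by blast
      then have "p ^ s \<le> p ^ b" using p(1) by (intro dvd_imp_le) (auto simp: prime_gt_0_nat)
      then show ?thesis using wlt b p by simp
    next
      assume "below z t"
      then have "p ^ b * m dvd p ^ s" using below_imp_ord_dvd tG z p by metis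
      then have "m dvd p ^ s" by (metis dvd_mult_right)
      moreover have "coprime m (p ^ s)" using co by (simp add: ac_simps)
      ultimately show ?thesis by (metis coprime_absorb_left nat_dvd_1_iff_1)
    qed
    then have ua: "ord u = p ^ a" using m by simp
    then have sa: "s < a" using lt p prime_gt_1_nat by (metis power_less_imp_less_exp)
    \<comment> \<open>The inclusion is proper since \<open>\<one>\<close> lies below
      \<open>t\<close> but is no twin of \<open>v\<close>. For \<open>p = 2\<close> and
      \<open>s = a - 1\<close> the estimates that follow, up to \<open>totient (ord u)\<close>, are
      equalities, so the strictness must come from here.\<close>
    have "card (twins v) < card {z. below z t}"
    proof (rule psubset_card_mono[OF finite_below[OF tG]])
      show "twins v \<subset> {z. below z t}" using top one_below one_not_twin v u by blast
    qed
    also have "\<dots> = p ^ s" using card_below tG p by simp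
    also have "\<dots> \<le> p ^ (a - 1) * 1" using sa p prime_gt_0_nat[of p] by (simp add: power_increasing)
    also have "\<dots> \<le> p ^ (a - 1) * (p - 1)" using p prime_gt_1_nat[of p] by (intro mult_left_mono) auto
    also have "\<dots> = totient (ord u)" using totient_prime_power[of p a] sa p ua by simp
    also have "\<dots> \<le> card (twins u)" using totient_le_card_twins u by blast
    finally show ?thesis by simp
  qed
  moreover have "totient (ord t) \<le> totient (ord u)"
    using totient_dvd_mono[OF ord_tu] ord_pos u by simp
  moreover have "totient (ord u) \<le> card (twins u)" using totient_le_card_twins u by blast
  ultimately show "card (twins v) \<le> card (twins u)"
    and "card (twins u) \<le> card (twins v) \<Longrightarrow> ord u = 2 * ord v \<and> odd (ord v)"
    using totient_eq_divisor[OF ord_tu lt] by (auto dest: order_trans)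
qed

end

section \<open>Isomorphisms of power graphs\<close>

context group
begin

lemma below_oneD: "below x \<one> \<Longrightarrow> x = \<one>"
  by (auto simp: below_def)

text \<open>A nontrivial \<open>z\<close> cannot lie below both \<open>x\<close> and
  \<open>y\<close>, as its order would divide coprime numbers. So either both lie below
  \<open>z\<close>, or \<open>z\<close> links them and one lies below the other; elements of one
  cyclic subgroup commute.\<close>

lemma commute_if_comparable_common:
  assumes "x \<in> carrier G" "y \<in> carrier G" "z \<in> carrier G" "z \<noteq> \<one>" "coprime (ord x) (ord y)"
    and "comparable x z" "comparable y z"
  shows "x \<otimes> y = y \<otimes> x"
proof -
  have "\<not> (below z x \<and> below z y)"
  proof
    assume "below z x \<and> below z y"
    then have "ord z dvd ord x" "ord z dvd ord y" using assms below_imp_ord_dvd by blast+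
    then have "ord z = 1" using assms(5) by (metis coprime_common_divisor_nat)
    then show False using assms ord_eq_1 by blast
  qed
  then consider "below x z" "below y z" | "below x y" | "below y x"
    using assms below_trans unfolding comparable_def by blast
  then show ?thesis
    using commute_if_below[of x z y] commute_if_below[of x y y] commute_if_below[of x x y]
      below_refl assms by cases auto
qed

lemma below_mult_coprime:
  assumes "x \<in> carrier G" "y \<in> carrier G" "x \<otimes> y = y \<otimes> x" "coprime (ord x) (ord y)"
  shows "below x (x \<otimes> y)"
proof -
  \<comment> \<open>The exponent \<open>ord y * m\<close> annihilates \<open>y\<close> and fixes
    \<open>x\<close>.\<close>
  obtain m where m: "[ord y * m = 1] (mod ord x)"
    using assms(4) coprime_iff_invertible_nat[of "ord y" "ord x"] by (auto simp: ac_simps)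
  have "(x \<otimes> y) [^] (ord y * m) = x [^] (ord y * m) \<otimes> y [^] (ord y * m)"
    using pow_mult_distrib assms by blast
  also have "y [^] (ord y * m) = \<one>" using assms(2) pow_eq_id by simp
  also have "x [^] (ord y * m) = x" using nat_pow_cong[OF assms(1) m] assms(1) by simp
  finally show ?thesis using assms(1) by (auto simp: below_def)
qed

text \<open>For a finite group this is equivalent to nilpotency, by
  \<open>nilpotent_prime_powers_commute\<close> and
  \<open>nilpotent_if_prime_powers_commute\<close>. It is phrased through elements and their orders
  because the power graph speaks about elements.\<close>

definition prime_powers_commute :: bool where
  "prime_powers_commute \<longleftrightarrow> (\<forall>x \<in> carrier G. \<forall>y \<in> carrier G. \<forall>p q i j.
     prime p \<longrightarrow> prime q \<longrightarrow> p \<noteq> q \<longrightarrow> ord x = p ^ i \<longrightarrow> ord y = q ^ j \<longrightarrow> x \<otimes> y = y \<otimes> x)"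

lemma prime_powers_commute_if_dominating:
  assumes z: "z \<in> carrier G" "z \<noteq> \<one>" and dom: "\<And>y. y \<in> carrier G \<Longrightarrow> comparable z y"
  shows prime_powers_commute
  unfolding prime_powers_commute_def
proof (intro ballI allI impI)
  fix x y and p q i j :: nat
  assume xy: "x \<in> carrier G" "y \<in> carrier G"
    and pq: "prime p" "prime q" "p \<noteq> q" "ord x = p ^ i" "ord y = q ^ j"
  then have "coprime (ord x) (ord y)" by (simp add: primes_coprime)
  then show "x \<otimes> y = y \<otimes> x"
    using commute_if_comparable_common[OF xy z] dom xy comparable_sym by blast
qed

end

section \<open>Comparability isomorphisms between reduced groups\<close>

locale comparability_iso =
  G: reduced_group G + H: reduced_group H for G (structure) and H (structure) +
  fixes f
  assumes bij: "bij_betw f (carrier G) (carrier H)"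
    and comparable_iff: "x \<in> carrier G \<Longrightarrow> y \<in> carrier G \<Longrightarrow>
      H.comparable (f x) (f y) \<longleftrightarrow> G.comparable x y"
begin

lemma f_closed: "x \<in> carrier G \<Longrightarrow> f x \<in> carrier H"
  using bij by (auto simp: bij_betw_def)

lemma f_surj: "y \<in> carrier H \<Longrightarrow> \<exists>x \<in> carrier G. f x = y"
  using bij_betw_imp_surj_on[OF bij] by (metis imageE)

lemma f_one: "f \<one>\<^bsub>G\<^esub> = \<one>\<^bsub>H\<^esub>"
proof (rule H.dominating)
  fix y assume "y \<in> carrier H"
  then obtain x where "x \<in> carrier G" "f x = y" using f_surj by blast
  then show "H.comparable (f \<one>\<^bsub>G\<^esub>) y"
    using comparable_iff[of "\<one>\<^bsub>G\<^esub>" x] by (auto simp: G.comparable_def G.one_below)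
qed (simp add: f_closed)

lemma f_eq_one: "x \<in> carrier G \<Longrightarrow> f x = \<one>\<^bsub>H\<^esub> \<Longrightarrow> x = \<one>\<^bsub>G\<^esub>"
  using bij f_one by (metis bij_betw_inv_into_left G.one_closed)

text \<open>The setting is symmetric in \<open>G\<close> and \<open>H\<close>; this lets
  \<open>twins_or_below_image\<close> obtain its reverse inclusion from
  \<open>twins_or_below_preserved\<close>.\<close>

lemma inverse: "comparability_iso H G (inv_into (carrier G) f)"
proof unfold_locales
  show "bij_betw (inv_into (carrier G) f) (carrier H) (carrier G)"
    using bij by (rule bij_betw_inv_into)
  fix x y assume "x \<in> carrier H" "y \<in> carrier H"
  then obtain a b where "a \<in> carrier G" "b \<in> carrier G" "f a = x" "f b = y" using f_surj by metis
  then show "G.comparable (inv_into (carrier G) f x) (inv_into (carrier G) f y) \<longleftrightarrow> H.comparable x y"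
    using comparable_iff bij_betw_inv_into_left[OF bij] by auto
qed

lemma twins_iff:
  assumes "x \<in> carrier G" "z \<in> carrier G"
  shows "f z \<in> H.twins (f x) \<longleftrightarrow> z \<in> G.twins x"
proof -
  have "(\<forall>w \<in> carrier H. H.comparable (f z) w \<longleftrightarrow> H.comparable (f x) w) \<longleftrightarrow>
      (\<forall>w \<in> carrier G. G.comparable z w \<longleftrightarrow> G.comparable x w)"
    using comparable_iff assms f_closed f_surj by metis
  then show ?thesis using assms f_closed by (simp add: G.twins_def H.twins_def)
qed

lemma card_twins:
  assumes "x \<in> carrier G"
  shows "card (H.twins (f x)) = card (G.twins x)"
proof -
  have "H.twins (f x) = f ` G.twins x"
    using twins_iff[OF assms] f_surj H.twins_closed G.twins_closed by (auto simp: image_iff) metis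
  moreover have "inj_on f (G.twins x)"
    using bij G.twins_closed by (auto simp: bij_betw_def intro: inj_on_subset)
  ultimately show ?thesis by (simp add: card_image)
qed

text \<open>In \<open>H\<close> the element \<open>f y\<close> lies above \<open>f x\<close> without
  being its twin, so \<open>card_twins_above\<close> bounds the number of twins of
  \<open>f x\<close> by that of \<open>f y\<close>. These numbers are preserved, so the pair
  \<open>y\<close>, \<open>x\<close> in \<open>G\<close> falls into the equality case.\<close>

lemma reversed_pair:
  assumes x: "x \<in> carrier G" "G.below y x" "y \<noteq> \<one>\<^bsub>G\<^esub>" "x \<notin> G.twins y"
    and rev: "H.below (f x) (f y)"
  shows "G.ord x = 2 * G.ord y \<and> odd (G.ord y)"
proof -
  have y: "y \<in> carrier G" using x G.below_closed by blast
  have "x \<noteq> \<one>\<^bsub>G\<^esub>" using x G.below_oneD by blast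
  then have fx: "f x \<noteq> \<one>\<^bsub>H\<^esub>" using f_eq_one x by blast
  have "y \<notin> G.twins x" using x y G.twins_eq G.twins_refl by blast
  then have "f y \<notin> H.twins (f x)" using twins_iff x y by blast
  then have "card (H.twins (f x)) \<le> card (H.twins (f y))"
    using H.card_twins_above(1) f_closed[OF y] rev fx by blast
  then show ?thesis using G.card_twins_above(2)[OF x] card_twins x y by simp
qed

lemma below_preserved:
  assumes x: "x \<in> carrier G" "G.below y x" "y \<noteq> \<one>\<^bsub>G\<^esub>" "x \<notin> G.twins y"
  shows "H.below (f y) (f x)"
proof (rule ccontr)
  assume neg: "\<not> ?thesis"
  have y: "y \<in> carrier G" using x G.below_closed by blast
  have "G.comparable x y" using x by (simp add: G.comparable_def)
  then have "H.comparable (f x) (f y)" using comparable_iff x y by blast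
  then have rev: "H.below (f x) (f y)" using neg by (simp add: H.comparable_def)
  then have ord: "G.ord x = 2 * G.ord y" "odd (G.ord y)" using reversed_pair[OF x] by auto
  \<comment> \<open>The involution \<open>u\<close> is incomparable with \<open>y\<close>, so \<open>(x, u)\<close> is reversed as well; but \<open>ord u\<close> is even.\<close>
  then obtain u where u: "G.below u x" "G.ord u = 2" using G.below_of_ord[OF x(1), of 2] by auto
  have uG: "u \<in> carrier G" using u x G.below_closed by blast
  have "G.ord y \<noteq> 1" using G.ord_eq_1 x y by blast
  \<comment> \<open>As \<open>ord y\<close> is odd and exceeds 1, neither of \<open>ord y\<close>
    and 2 divides the other.\<close>
  then have "\<not> G.ord y dvd 2" using ord(2) by (metis dvd_refl two_is_prime_nat prime_nat_iff)
  then have uy: "\<not> G.comparable u y"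
    using ord(2) u G.below_imp_ord_dvd uG y unfolding G.comparable_def by metis
  then have xu: "x \<notin> G.twins u"
    using G.comparable_twin[of x u y] \<open>G.comparable x y\<close> y by blast
  have u1: "u \<noteq> \<one>\<^bsub>G\<^esub>" using u by auto
  have "G.comparable x u" using u by (simp add: G.comparable_def)
  then have "H.comparable (f x) (f u)" using comparable_iff x uG by blast
  moreover have "\<not> H.below (f u) (f x)"
  proof
    assume "H.below (f u) (f x)"
    then have "H.comparable (f u) (f y)" using rev H.below_trans f_closed y unfolding H.comparable_def by blast
    then show False using uy comparable_iff uG y by blast
  qed
  ultimately have "H.below (f x) (f u)" by (simp add: H.comparable_def)
  then have "odd (G.ord u)" using reversed_pair[OF x(1) u(1) u1 xu] by blast
  then show False using u by simp
qed

text \<open>Inside a twin class \<open>f\<close> may turn the direction of a power around, but it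
  respects the class; outside it \<open>below_preserved\<close> applies. The identity is a case of
  its own because \<open>below_preserved\<close> excludes it.\<close>

lemma twins_or_below_preserved:
  assumes x: "x \<in> carrier G" and z: "z \<in> G.twins x \<or> G.below z x"
  shows "f z \<in> H.twins (f x) \<or> H.below (f z) (f x)"
proof -
  have zG: "z \<in> carrier G" using z x G.below_closed G.twins_closed by blast
  consider "z \<in> G.twins x" | "z = \<one>\<^bsub>G\<^esub>" | "G.below z x" "z \<noteq> \<one>\<^bsub>G\<^esub>" "x \<notin> G.twins z"
    using z x zG G.twins_eq G.twins_refl by blast
  then show ?thesis
  proof cases
    case 1
    then show ?thesis using twins_iff x zG by blast
  next
    case 2
    then show ?thesis by (simp add: f_one H.one_below)
  next
    case 3
    then show ?thesis using below_preserved x by blast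
  qed
qed

lemma twins_or_below_image:
  assumes x: "x \<in> carrier G"
  shows "f ` {z. z \<in> G.twins x \<or> G.below z x} = {z. z \<in> H.twins (f x) \<or> H.below z (f x)}"
proof -
  interpret inv: comparability_iso H G "inv_into (carrier G) f" by (rule inverse)
  have "z \<in> f ` {z. z \<in> G.twins x \<or> G.below z x}" if z: "z \<in> H.twins (f x) \<or> H.below z (f x)" for z
  proof -
    have "z \<in> carrier H" using z x f_closed H.below_closed H.twins_closed by blast
    then obtain w where w: "w \<in> carrier G" "f w = z" using f_surj by blast
    have "w \<in> G.twins x \<or> G.below w x"
      using inv.twins_or_below_preserved[OF f_closed[OF x] z] bij_betw_inv_into_left[OF bij] w x by auto
    then show ?thesis using w by blast
  qed
  then show ?thesis using twins_or_below_preserved[OF x] by blast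
qed

text \<open>The cyclic subgroups of the top twins \<open>t\<close> and \<open>t'\<close> correspond
  under \<open>f\<close>, so their orders agree. Either \<open>ord t\<close> equals
  \<open>ord x\<close>, or it is a prime power by \<open>twins_prime_power\<close>, and the prime is
  \<open>p\<close> because the nontrivial \<open>x\<close> lies below \<open>t\<close>. Finally
  \<open>f x\<close> lies below \<open>t'\<close>.\<close>

lemma prime_power_ord:
  assumes x: "x \<in> carrier G" "x \<noteq> \<one>\<^bsub>G\<^esub>" and p: "prime p" "G.ord x = p ^ i"
  shows "\<exists>j. H.ord (f x) = p ^ j"
proof -
  obtain t where t: "t \<in> G.twins x" "\<And>z. z \<in> G.twins x \<Longrightarrow> G.below z t"
    using G.twins_top x by blast
  have fx: "f x \<in> carrier H" "f x \<noteq> \<one>\<^bsub>H\<^esub>" using f_closed f_eq_one x by blast+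
  obtain t' where t': "t' \<in> H.twins (f x)" "\<And>z. z \<in> H.twins (f x) \<Longrightarrow> H.below z t'"
    using H.twins_top fx by blast
  have tG: "t \<in> carrier G" and t'H: "t' \<in> carrier H" using t t' G.twins_closed H.twins_closed by blast+
  have "f ` {z. G.below z t} = {z. H.below z t'}"
    using twins_or_below_image[OF x(1)] G.twins_or_below_eq[OF x t] H.twins_or_below_eq[OF fx t'] by simp
  moreover have "inj_on f {z. G.below z t}"
    using bij G.below_closed[OF _ tG] by (auto simp: bij_betw_def intro: inj_on_subset)
  ultimately have ord_eq: "H.ord t' = G.ord t"
    using G.card_below[OF tG] H.card_below[OF t'H] card_image by metis
  have xt: "G.below x t" using t G.twins_refl x by blast
  have "\<exists>s. G.ord t = p ^ s"
  proof (cases "G.ord x = G.ord t")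
    case True
    then show ?thesis using p by metis
  next
    case False
    then have "G.ord x < G.ord t"
      using G.below_imp_ord_dvd[OF xt tG] G.ord_pos[OF tG] dvd_imp_le le_neq_implies_less by metis
    moreover have "x \<in> G.twins t" using t G.twins_eq G.twins_refl x by blast
    ultimately obtain q s where q: "prime q" "G.ord t = q ^ s"
      using G.twins_prime_power[OF tG _ xt] x by blast
    have "G.ord x \<noteq> 1" using G.ord_eq_1 x by blast
    then have "i \<noteq> 0" using p by (cases i) auto
    then have "p dvd G.ord x" using p by simp
    then have "p dvd q ^ s" using G.below_imp_ord_dvd[OF xt tG] q dvd_trans by metis
    then have "p = q" using p q by (metis prime_dvd_power primes_dvd_imp_eq)
    then show ?thesis using q by blast
  qed
  then obtain s where "H.ord t' = p ^ s" using ord_eq by auto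
  moreover have "H.ord (f x) dvd H.ord t'" using t' H.twins_refl fx H.below_imp_ord_dvd t'H by blast
  ultimately show ?thesis using divides_primepow_nat[OF p(1)] by auto
qed

lemma prime_powers_commute_transfer:
  assumes "H.prime_powers_commute"
  shows "G.prime_powers_commute"
  unfolding G.prime_powers_commute_def
proof (intro ballI allI impI)
  fix x y and p q i j :: nat
  assume x: "x \<in> carrier G" and y: "y \<in> carrier G"
    and pq: "prime p" "prime q" "p \<noteq> q" and xi: "G.ord x = p ^ i" and yj: "G.ord y = q ^ j"
  show "x \<otimes>\<^bsub>G\<^esub> y = y \<otimes>\<^bsub>G\<^esub> x"
  \<comment> \<open>The identity is treated apart, since \<open>prime_power_ord\<close> speaks of
    nontrivial elements only.\<close>
  proof (cases "x = \<one>\<^bsub>G\<^esub> \<or> y = \<one>\<^bsub>G\<^esub>")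
    case True
    then show ?thesis using x y by auto
  next
    case False
    obtain a b where ab: "H.ord (f x) = p ^ a" "H.ord (f y) = q ^ b"
      using prime_power_ord False x y pq xi yj by metis
    have fxy: "f x \<in> carrier H" "f y \<in> carrier H" using f_closed x y by auto
    define z where "z = f x \<otimes>\<^bsub>H\<^esub> f y"
    have comm: "f x \<otimes>\<^bsub>H\<^esub> f y = f y \<otimes>\<^bsub>H\<^esub> f x"
      using assms fxy ab pq unfolding H.prime_powers_commute_def by blast
    have co: "coprime (H.ord (f x)) (H.ord (f y))" using ab pq by (simp add: primes_coprime)
    have bx: "H.below (f x) z" unfolding z_def using H.below_mult_coprime fxy comm co by blast
    have "H.below (f y) z" unfolding z_def comm
      using H.below_mult_coprime[of "f y" "f x"] fxy comm co by (simp add: ac_simps)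
    moreover have "z \<in> carrier H" using fxy by (simp add: z_def)
    then obtain w where w: "w \<in> carrier G" "f w = z" using f_surj by blast
    ultimately have "G.comparable x w" "G.comparable y w"
      using bx comparable_iff x y unfolding H.comparable_def by blast+
    moreover have "w \<noteq> \<one>\<^bsub>G\<^esub>" using w f_one bx H.below_oneD f_eq_one x False by metis
    moreover have "coprime (G.ord x) (G.ord y)" using xi yj pq by (simp add: primes_coprime)
    ultimately show ?thesis using G.commute_if_comparable_common[OF x y w(1)] by blast
  qed
qed

end

section \<open>Commutators and nilpotency\<close>

context group
begin

lemma commute_inv:
  assumes "x \<in> carrier G" "g \<in> carrier G" "x \<otimes> g = g \<otimes> x"
  shows "x \<otimes> inv g = inv g \<otimes> x"
proof -
  have "inv g \<otimes> (x \<otimes> g) \<otimes> inv g = inv g \<otimes> (g \<otimes> x) \<otimes> inv g"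
    using assms by simp
  moreover have "inv g \<otimes> (g \<otimes> x) = x" using assms by (simp add: m_assoc[symmetric])
  ultimately show ?thesis using assms(1,2) by (simp add: m_assoc)
qed

lemma commute_mult:
  assumes "x \<in> carrier G" "g \<in> carrier G" "h \<in> carrier G" "x \<otimes> g = g \<otimes> x" "x \<otimes> h = h \<otimes> x"
  shows "x \<otimes> (g \<otimes> h) = g \<otimes> h \<otimes> x"
proof -
  have "x \<otimes> (g \<otimes> h) = g \<otimes> x \<otimes> h" using assms by (simp add: m_assoc[symmetric])
  then show ?thesis using assms by (simp add: m_assoc)
qed

lemma conj_pow:
  fixes n :: nat
  assumes "x \<in> carrier G" "y \<in> carrier G"
  shows "(x \<otimes> y \<otimes> inv x) [^] n = x \<otimes> y [^] n \<otimes> inv x"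
proof (induction n)
  case (Suc n)
  have "inv x \<otimes> (x \<otimes> z) = z" if "z \<in> carrier G" for z
    using assms that by (simp add: m_assoc[symmetric])
  then show ?case using assms Suc by (simp add: m_assoc)
qed (use assms in simp)

text \<open>\<open>c \<otimes> y\<close> is the conjugate of \<open>y\<close> by \<open>x\<close>,
  so its power with exponent \<open>ord y\<close> is trivial. As \<open>c\<close> and
  \<open>y\<close> commute, that power is \<open>c [^] ord y \<otimes> y [^] ord y\<close>, whose
  second factor is trivial too.\<close>

lemma commutator_pow_left:
  assumes x: "x \<in> carrier G" and y: "y \<in> carrier G" and c: "c = x \<otimes> y \<otimes> inv x \<otimes> inv y"
    and cy: "c \<otimes> y = y \<otimes> c"
  shows "c [^] ord y = \<one>"
proof -
  have cG: "c \<in> carrier G" using x y c by simp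
  have "c \<otimes> y = x \<otimes> y \<otimes> inv x" unfolding c using x y by (simp add: m_assoc)
  then have "c [^] ord y \<otimes> y [^] ord y = (x \<otimes> y \<otimes> inv x) [^] ord y"
    using pow_mult_distrib[OF cy cG y] by simp
  then show ?thesis using x y cG conj_pow by simp
qed

lemma commutator_eq_one_iff:
  assumes "x \<in> carrier G" "y \<in> carrier G"
  shows "x \<otimes> y \<otimes> inv x \<otimes> inv y = \<one> \<longleftrightarrow> x \<otimes> y = y \<otimes> x"
proof -
  have "x \<otimes> y \<otimes> inv x \<otimes> inv y = (x \<otimes> y) \<otimes> inv (y \<otimes> x)"
    using assms by (simp add: m_assoc inv_mult_group)
  then show ?thesis using assms by (metis inv_equality inv_inv m_closed r_inv inv_closed)
qed

text \<open>The inverse of \<open>c\<close> is the commutator of \<open>y\<close> and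
  \<open>x\<close>, so \<open>commutator_pow_left\<close> applies on both sides and
  \<open>ord c\<close> divides both orders. Exponents \<open>m\<close> and \<open>n\<close> stand in
  for the orders because the application is in a quotient, where orders may drop.\<close>

lemma central_commutator_coprime:
  assumes x: "x \<in> carrier G" and y: "y \<in> carrier G" and c: "c = x \<otimes> y \<otimes> inv x \<otimes> inv y"
    and comm: "c \<otimes> x = x \<otimes> c" "c \<otimes> y = y \<otimes> c"
    and m: "x [^] (m::nat) = \<one>" and n: "y [^] (n::nat) = \<one>" and co: "coprime m n"
  shows "c = \<one>"
proof -
  have cG: "c \<in> carrier G" using x y c by simp
  have "inv c = y \<otimes> x \<otimes> inv y \<otimes> inv x" unfolding c
    using x y by (simp add: m_assoc inv_mult_group)
  moreover have "inv c \<otimes> x = x \<otimes> inv c" using commute_inv[OF x cG] comm(1) by simp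
  ultimately have "inv c [^] ord x = \<one>" using commutator_pow_left[OF y x] by blast
  then have "ord c dvd ord x" using pow_eq_id[of "inv c"] cG by simp
  moreover have "ord c dvd ord y" using commutator_pow_left[OF x y c comm(2)] pow_eq_id cG by blast
  moreover have "ord x dvd m" "ord y dvd n" using m n x y pow_eq_id by blast+
  ultimately have "ord c = 1" using co by (meson coprime_common_divisor_nat dvd_trans)
  then show ?thesis using ord_eq_1 cG by blast
qed

end

section \<open>Commutators modulo a normal subgroup\<close>

context normal
begin

lemma coset_eq_iff:
  assumes "a \<in> carrier G" "b \<in> carrier G"
  shows "H #> a = H #> b \<longleftrightarrow> a \<otimes> inv b \<in> H"
  using assms rcos_module[OF is_group] repr_independence repr_independenceD subgroup_axioms by metis

text \<open>The commutator equals \<open>(x \<otimes> y) \<otimes> inv (y \<otimes> x)\<close>,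
  which lies in \<open>H\<close> exactly if the two products have the same coset.\<close>

lemma commutator_mem_iff:
  assumes "x \<in> carrier G" "y \<in> carrier G"
  shows "x \<otimes> y \<otimes> inv x \<otimes> inv y \<in> H \<longleftrightarrow>
    (H #> x) \<otimes>\<^bsub>G Mod H\<^esub> (H #> y) = (H #> y) \<otimes>\<^bsub>G Mod H\<^esub> (H #> x)"
proof -
  have "x \<otimes> y \<otimes> inv x \<otimes> inv y = (x \<otimes> y) \<otimes> inv (y \<otimes> x)"
    using assms by (simp add: m_assoc inv_mult_group)
  then show ?thesis using coset_eq_iff[of "x \<otimes> y" "y \<otimes> x"] assms by (simp add: rcos_sum)
qed

lemma group_hom_Mod: "group_hom G (G Mod H) (\<lambda>a. H #> a)"
  by (simp add: group_hom_def group_hom_axioms_def is_group factorgroup_is_group r_coset_hom_Mod)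

text \<open>The set is the preimage of the centralizer of the coset \<open>H #> x\<close> in
  \<open>G Mod H\<close>.\<close>

lemma commutator_centralizer_subgroup:
  assumes x: "x \<in> carrier G"
  shows "subgroup {g \<in> carrier G. x \<otimes> g \<otimes> inv x \<otimes> inv g \<in> H} G"
proof -
  interpret Q: group_hom G "G Mod H" "\<lambda>a. H #> a" by (rule group_hom_Mod)
  let ?X = "H #> x"
  have eq: "{g \<in> carrier G. x \<otimes> g \<otimes> inv x \<otimes> inv g \<in> H} =
      {g \<in> carrier G. ?X \<otimes>\<^bsub>G Mod H\<^esub> (H #> g) = (H #> g) \<otimes>\<^bsub>G Mod H\<^esub> ?X}"
    using commutator_mem_iff[OF x] by blast
  show ?thesis unfolding eq
  proof (rule subgroupI)
    show "{g \<in> carrier G. ?X \<otimes>\<^bsub>G Mod H\<^esub> (H #> g) = (H #> g) \<otimes>\<^bsub>G Mod H\<^esub> ?X} \<noteq> {}"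
      using x by blast
  next
    fix g assume g: "g \<in> {g \<in> carrier G. ?X \<otimes>\<^bsub>G Mod H\<^esub> (H #> g) = (H #> g) \<otimes>\<^bsub>G Mod H\<^esub> ?X}"
    have "H #> inv g = inv\<^bsub>G Mod H\<^esub> (H #> g)" using Q.hom_inv g by blast
    moreover have "?X \<otimes>\<^bsub>G Mod H\<^esub> inv\<^bsub>G Mod H\<^esub> (H #> g) = inv\<^bsub>G Mod H\<^esub> (H #> g) \<otimes>\<^bsub>G Mod H\<^esub> ?X"
      using Q.H.commute_inv g x Q.hom_closed by blast
    ultimately show "inv g \<in> {g \<in> carrier G. ?X \<otimes>\<^bsub>G Mod H\<^esub> (H #> g) = (H #> g) \<otimes>\<^bsub>G Mod H\<^esub> ?X}"
      using g by simp
  next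
    fix g h
    assume gh: "g \<in> {g \<in> carrier G. ?X \<otimes>\<^bsub>G Mod H\<^esub> (H #> g) = (H #> g) \<otimes>\<^bsub>G Mod H\<^esub> ?X}"
      "h \<in> {g \<in> carrier G. ?X \<otimes>\<^bsub>G Mod H\<^esub> (H #> g) = (H #> g) \<otimes>\<^bsub>G Mod H\<^esub> ?X}"
    have "H #> (g \<otimes> h) = (H #> g) \<otimes>\<^bsub>G Mod H\<^esub> (H #> h)" using Q.hom_mult gh by blast
    moreover have "?X \<otimes>\<^bsub>G Mod H\<^esub> ((H #> g) \<otimes>\<^bsub>G Mod H\<^esub> (H #> h)) = ((H #> g) \<otimes>\<^bsub>G Mod H\<^esub> (H #> h)) \<otimes>\<^bsub>G Mod H\<^esub> ?X"
      using Q.H.commute_mult gh x Q.hom_closed by blast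
    ultimately show "g \<otimes> h \<in> {g \<in> carrier G. ?X \<otimes>\<^bsub>G Mod H\<^esub> (H #> g) = (H #> g) \<otimes>\<^bsub>G Mod H\<^esub> ?X}"
      using gh by simp
  qed auto
qed

text \<open>The set is the preimage of the centre of \<open>G Mod H\<close>.\<close>

lemma central_preimage_normal:
  "{x \<in> carrier G. \<forall>g \<in> carrier G. x \<otimes> g \<otimes> inv x \<otimes> inv g \<in> H} \<lhd> G" (is "?M \<lhd> G")
proof -
  interpret Q: group_hom G "G Mod H" "\<lambda>a. H #> a" by (rule group_hom_Mod)
  have M: "?M = {x \<in> carrier G. \<forall>g \<in> carrier G. (H #> g) \<otimes>\<^bsub>G Mod H\<^esub> (H #> x) = (H #> x) \<otimes>\<^bsub>G Mod H\<^esub> (H #> g)}"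
    using commutator_mem_iff by (auto simp: eq_commute)
  \<comment> \<open>Commuting of cosets is symmetric, so \<open>x\<close> and \<open>g\<close> may
    trade places; this exhibits the set as an intersection of the subgroups from
    \<open>commutator_centralizer_subgroup\<close>.\<close>
  have "?M = carrier G \<inter> (\<Inter>g \<in> carrier G. {x \<in> carrier G. g \<otimes> x \<otimes> inv g \<otimes> inv x \<in> H})"
    unfolding M using commutator_mem_iff by auto
  also have "\<dots> = (\<Inter>g \<in> carrier G. {x \<in> carrier G. g \<otimes> x \<otimes> inv g \<otimes> inv x \<in> H})"
    by blast
  finally have "subgroup ?M G"
    using subgroups_Inter[of "(\<lambda>g. {x \<in> carrier G. g \<otimes> x \<otimes> inv g \<otimes> inv x \<in> H}) ` carrier G"]
      commutator_centralizer_subgroup by auto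
  then show ?thesis
  proof (rule normal_invI)
    fix g x assume g: "g \<in> carrier G" and x: "x \<in> ?M"
    then have xG: "x \<in> carrier G" by blast
    have "H #> (g \<otimes> x) = H #> (x \<otimes> g)" using x g xG Q.hom_mult unfolding M by auto
    then have "H #> (g \<otimes> x \<otimes> inv g) = H #> (x \<otimes> g \<otimes> inv g)"
      using g xG Q.hom_mult by simp
    then have "H #> (g \<otimes> x \<otimes> inv g) = H #> x" using g xG by (simp add: m_assoc)
    then show "g \<otimes> x \<otimes> inv g \<in> ?M" using x g xG unfolding M by simp
  qed
qed

end

section \<open>The lower central series, and centres of p-groups\<close>

context group
begin

text \<open>A conjugate of a commutator is the commutator of the conjugates, so once a term is
  normal, the set generating the next one is invariant under conjugation.\<close>

lemma lower_central_series_normal: "lower_central_series G n \<lhd> G"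
proof (induction n)
  case 0
  show ?case using normal_invI[OF subgroup_self] by simp
next
  case (Suc n)
  then interpret N: normal "lower_central_series G n" G .
  show ?case unfolding lower_central_series.simps
  proof (rule normal_generateI)
    fix h g assume "h \<in> (\<Union>x \<in> lower_central_series G n. \<Union>y \<in> carrier G. {x \<otimes> y \<otimes> inv x \<otimes> inv y})"
      and g: "g \<in> carrier G"
    then obtain x y where xy: "x \<in> lower_central_series G n" "y \<in> carrier G" "h = x \<otimes> y \<otimes> inv x \<otimes> inv y"
      by blast
    have x: "x \<in> carrier G" using xy N.subset by blast
    have cancel: "inv g \<otimes> (g \<otimes> z) = z" if "z \<in> carrier G" for z
      using g that by (simp add: m_assoc[symmetric])
    let ?x = "g \<otimes> x \<otimes> inv g" and ?y = "g \<otimes> y \<otimes> inv g"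
    have "g \<otimes> h \<otimes> inv g = ?x \<otimes> ?y \<otimes> inv ?x \<otimes> inv ?y"
      using g x xy by (simp add: m_assoc inv_mult_group cancel)
    moreover have "?x \<in> lower_central_series G n" using N.inv_op_closed2 g xy by blast
    moreover have "?y \<in> carrier G" using g xy by simp
    ultimately show "g \<otimes> h \<otimes> inv g \<in> (\<Union>x \<in> lower_central_series G n. \<Union>y \<in> carrier G. {x \<otimes> y \<otimes> inv x \<otimes> inv y})"
      by (intro UN_I[of ?x] UN_I[of ?y]) simp_all
  qed (use N.subset in auto)
qed

lemma commutator_mem_lower_central_series:
  assumes "x \<in> lower_central_series G n" "y \<in> carrier G"
  shows "x \<otimes> y \<otimes> inv x \<otimes> inv y \<in> lower_central_series G (Suc n)"
  using assms by (auto intro!: generate.incl)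

text \<open>If the commutator \<open>c\<close> lies in term \<open>n\<close>, its coset modulo term
  \<open>Suc n\<close> commutes with those of \<open>x\<close> and \<open>y\<close>. Then
  \<open>central_commutator_coprime\<close> makes that coset trivial, and \<open>c\<close> lies in
  the next term.\<close>

lemma commutator_coprime_mem_lower_central_series:
  assumes x: "x \<in> carrier G" and y: "y \<in> carrier G" and co: "coprime (ord x) (ord y)"
  shows "x \<otimes> y \<otimes> inv x \<otimes> inv y \<in> lower_central_series G n"
proof (induction n)
  case 0
  show ?case using x y by simp
next
  case (Suc n)
  let ?N = "lower_central_series G (Suc n)"
  define c where "c = x \<otimes> y \<otimes> inv x \<otimes> inv y"
  have cG: "c \<in> carrier G" using x y by (simp add: c_def)
  interpret N: normal ?N G by (rule lower_central_series_normal)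
  interpret Q: group_hom G "G Mod ?N" "\<lambda>a. ?N #> a" by (rule N.group_hom_Mod)
  have "?N #> c = \<one>\<^bsub>G Mod ?N\<^esub>"
  proof (rule Q.H.central_commutator_coprime)
    show "?N #> x \<in> carrier (G Mod ?N)" "?N #> y \<in> carrier (G Mod ?N)" using x y Q.hom_closed by blast+
    show "?N #> c = (?N #> x) \<otimes>\<^bsub>G Mod ?N\<^esub> (?N #> y) \<otimes>\<^bsub>G Mod ?N\<^esub> inv\<^bsub>G Mod ?N\<^esub> (?N #> x) \<otimes>\<^bsub>G Mod ?N\<^esub> inv\<^bsub>G Mod ?N\<^esub> (?N #> y)"
      using x y by (simp only: c_def Q.hom_mult Q.hom_inv m_closed inv_closed)
    have "c \<in> lower_central_series G n" using Suc by (simp add: c_def)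
    then show "(?N #> c) \<otimes>\<^bsub>G Mod ?N\<^esub> (?N #> x) = (?N #> x) \<otimes>\<^bsub>G Mod ?N\<^esub> (?N #> c)"
      "(?N #> c) \<otimes>\<^bsub>G Mod ?N\<^esub> (?N #> y) = (?N #> y) \<otimes>\<^bsub>G Mod ?N\<^esub> (?N #> c)"
      using commutator_mem_lower_central_series N.commutator_mem_iff[OF cG] x y by blast+
    show "(?N #> x) [^]\<^bsub>G Mod ?N\<^esub> ord x = \<one>\<^bsub>G Mod ?N\<^esub>"
      using Q.hom_nat_pow[OF x, of "ord x"] pow_ord_eq_1[OF x] Q.hom_one by simp
    show "(?N #> y) [^]\<^bsub>G Mod ?N\<^esub> ord y = \<one>\<^bsub>G Mod ?N\<^esub>"
      using Q.hom_nat_pow[OF y, of "ord y"] pow_ord_eq_1[OF y] Q.hom_one by simp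
    show "coprime (ord x) (ord y)" by (rule co)
  qed
  then have "?N #> c = ?N" by simp
  then show ?case using coset_join1 cG N.subgroup_axioms unfolding c_def by blast
qed

lemma nilpotent_prime_powers_commute:
  assumes "nilpotent G"
  shows prime_powers_commute
  unfolding prime_powers_commute_def
proof (intro ballI allI impI)
  fix x y and p q i j :: nat
  assume xy: "x \<in> carrier G" "y \<in> carrier G"
    and pq: "prime p" "prime q" "p \<noteq> q" "ord x = p ^ i" "ord y = q ^ j"
  then have "coprime (ord x) (ord y)" by (simp add: primes_coprime)
  moreover obtain n where "lower_central_series G n = {\<one>}" using assms by (auto simp: nilpotent_def)
  ultimately have "x \<otimes> y \<otimes> inv x \<otimes> inv y = \<one>"
    using commutator_coprime_mem_lower_central_series[OF xy, of n] by simp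
  then show "x \<otimes> y = y \<otimes> x" using commutator_eq_one_iff xy by blast
qed

text \<open>The class equation: with a trivial centre, every conjugacy class but
  \<open>{\<one>}\<close> would have a size that is a power of \<open>p\<close> other than 1, and
  \<open>p\<close> would divide 1.\<close>

lemma p_group_center_nontrivial:
  assumes p: "prime p" and G: "order G = p ^ a" "a > 0"
  obtains z where "z \<in> carrier G" "z \<noteq> \<one>" "\<And>g. g \<in> carrier G \<Longrightarrow> z \<otimes> g = g \<otimes> z"
proof (rule ccontr)
  assume neg: "\<not> thesis"
  note ex = that
  define act where "act = (\<lambda>g. \<lambda>h \<in> carrier G. g \<otimes> h \<otimes> inv g)"
  interpret A: group_action G "carrier G" act unfolding act_def by (rule action_by_conjugation)
  have "order G > 0" using p G prime_gt_0_nat by simp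
  then have fin: "finite (carrier G)" by (simp add: order_gt_0_iff_finite)
  have orb: "orbit G act x = {g \<otimes> x \<otimes> inv g | g. g \<in> carrier G}" if "x \<in> carrier G" for x
    using that by (auto simp: orbit_def act_def)
  have orb1: "orbit G act \<one> = {\<one>}" unfolding orb[OF one_closed] by (auto intro!: exI[of _ "\<one>"])
  have dvd: "p dvd card T" if T: "T \<in> orbits G (carrier G) act - {{\<one>}}" for T
  proof -
    obtain x where x: "x \<in> carrier G" "T = orbit G act x" using T by (auto simp: orbits_def)
    have x1: "x \<noteq> \<one>" using T x orb1 by blast
    have "card T * card (stabilizer G act x) = p ^ a"
      using A.orbit_stabilizer_theorem[OF x(1)] x G by simp
    then have "card T dvd p ^ a" by (metis dvd_triv_left)
    then obtain i where i: "card T = p ^ i" using divides_primepow_nat[OF p] by auto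
    \<comment> \<open>A class with one element consists of a central element.\<close>
    have "card T \<noteq> 1"
    proof
      assume "card T = 1"
      then obtain w where w: "T = {w}" by (metis card_1_singletonE)
      have "g \<otimes> x \<otimes> inv g = w" if "g \<in> carrier G" for g using that w x orb[OF x(1)] by blast
      from this[OF one_closed] have "x = w" using x(1) by simp
      then have "g \<otimes> x \<otimes> inv g = x" if "g \<in> carrier G" for g
        using that \<open>\<And>g. g \<in> carrier G \<Longrightarrow> g \<otimes> x \<otimes> inv g = w\<close>
        by simp
      then have "x \<otimes> g = g \<otimes> x" if "g \<in> carrier G" for g
        using that x by (metis inv_solve_right m_closed)
      then show False using ex neg x x1 by blast
    qed
    then show ?thesis using i by (cases i) auto
  qed
  have sub: "\<And>T. T \<in> orbits G (carrier G) act \<Longrightarrow> T \<subseteq> carrier G"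
    using A.orbits_coverture by blast
  then have finO: "finite (orbits G (carrier G) act)"
    using finite_subset[of "orbits G (carrier G) act" "Pow (carrier G)"] fin by blast
  have one_orb: "{\<one>} \<in> orbits G (carrier G) act" using orb1 unfolding orbits_def by blast
  have "p ^ a = (\<Sum>T \<in> orbits G (carrier G) act. card T)"
    using A.disjoint_sum[OF fin, of "\<lambda>_. 1::nat"] G by (simp add: order_def)
  also have "\<dots> = 1 + (\<Sum>T \<in> orbits G (carrier G) act - {{\<one>}}. card T)"
    using sum.remove[OF finO one_orb, of card] by simp
  finally have "p ^ a = 1 + (\<Sum>T \<in> orbits G (carrier G) act - {{\<one>}}. card T)" .
  moreover have "p dvd (\<Sum>T \<in> orbits G (carrier G) act - {{\<one>}}. card T)" using dvd by (rule dvd_sum)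
  moreover have "p dvd p ^ a" using G by simp
  ultimately have "p dvd 1" by (metis dvd_add_left_iff)
  then show False using p by auto
qed

end

section \<open>Sylow subgroups and the criterion for nilpotency\<close>

context finite_group
begin

lemma sylow_subgroup_exists:
  assumes "prime p"
  obtains P where "subgroup P G" "card P = p ^ multiplicity p (order G)"
proof -
  have "order G = p ^ multiplicity p (order G) * (order G div p ^ multiplicity p (order G))"
    by (simp add: multiplicity_dvd)
  then show ?thesis using sylow_thm[OF assms is_group _ fin] that by blast
qed

lemma ord_in_p_subgroup:
  assumes "prime p" "subgroup P G" "card P = p ^ a" "x \<in> P"
  shows "\<exists>i. ord x = p ^ i"
proof -
  interpret P: group "G\<lparr>carrier := P\<rparr>" using assms(2) subgroup_imp_group by blast
  have xG: "x \<in> carrier G" using assms subgroup.subset by blast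
  have "x [^]\<^bsub>G\<lparr>carrier := P\<rparr>\<^esub> order (G\<lparr>carrier := P\<rparr>) = \<one>"
    using P.pow_order_eq_1[of x] assms by simp
  then have "x [^] (p ^ a) = \<one>" using assms nat_pow_consistent by (simp add: order_def)
  then have "ord x dvd p ^ a" using pow_eq_id xG by blast
  then show ?thesis using divides_primepow_nat[OF assms(1)] by auto
qed

text \<open>By Lagrange, \<open>card C\<close> is divisible by the full \<open>p\<close>-part of
  \<open>order G\<close> for every prime \<open>p\<close>, hence by \<open>order G\<close>.\<close>

lemma subgroup_containing_sylows:
  assumes C: "subgroup C G"
    and P: "\<And>p. prime p \<Longrightarrow> \<exists>P. subgroup P G \<and> P \<subseteq> C \<and> card P = p ^ multiplicity p (order G)"
  shows "C = carrier G"
proof -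
  have CG: "C \<subseteq> carrier G" using C subgroup.subset by blast
  have finC: "finite C" using CG fin finite_subset by blast
  have C0: "card C > 0" using C subgroup.one_closed finC by (fastforce simp: card_gt_0_iff)
  have G0: "order G \<noteq> 0" using fin order_gt_0_iff_finite by simp
  have "order G dvd card C"
  proof (rule multiplicity_le_imp_dvd[OF G0])
    fix p :: nat assume p: "prime p"
    obtain P where P: "subgroup P G" "P \<subseteq> C" "card P = p ^ multiplicity p (order G)" using P p by blast
    interpret CG: group "G\<lparr>carrier := C\<rparr>" using C subgroup_imp_group by blast
    have "subgroup P (G\<lparr>carrier := C\<rparr>)" using subgroup_incl P C by blast
    then have "card P dvd card C" using CG.lagrange[of P] by (simp add: order_def) (metis dvd_triv_right)
    then show "multiplicity p (order G) \<le> multiplicity p (card C)"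
      using P C0 p by (intro multiplicity_geI) auto
  qed
  then have "card (carrier G) \<le> card C" using C0 dvd_imp_le by (simp add: order_def)
  then show ?thesis using CG fin card_seteq by blast
qed

text \<open>For some prime \<open>p\<close> no Sylow \<open>p\<close>-subgroup lies in
  \<open>N\<close>, so \<open>P\<close> modulo \<open>N \<inter> P\<close> is a nontrivial p-group,
  and \<open>x\<close> lifts a nontrivial central element of it. Modulo \<open>N\<close>, this
  \<open>x\<close> commutes with \<open>P\<close>, and by hypothesis it commutes with Sylow
  subgroups for the other primes. By \<open>subgroup_containing_sylows\<close> it then commutes
  modulo \<open>N\<close> with all of \<open>G\<close>.\<close>

lemma central_mod_normal:
  assumes comm: prime_powers_commute and N: "N \<lhd> G" "N \<noteq> carrier G"
  shows "\<exists>x \<in> carrier G. x \<notin> N \<and> (\<forall>g \<in> carrier G. x \<otimes> g \<otimes> inv x \<otimes> inv g \<in> N)"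
proof -
  interpret N: normal N G by (rule N(1))
  obtain p where p: "prime p"
    and no: "\<And>P. subgroup P G \<Longrightarrow> card P = p ^ multiplicity p (order G) \<Longrightarrow> \<not> P \<subseteq> N"
    using subgroup_containing_sylows[OF N.subgroup_axioms] N(2) by blast
  obtain P where P: "subgroup P G" and cardP: "card P = p ^ multiplicity p (order G)"
    using sylow_subgroup_exists[OF p] .
  have PG: "P \<subseteq> carrier G" using P subgroup.subset by blast
  let ?S = "G\<lparr>carrier := P\<rparr>"
  interpret S: group ?S using P subgroup_imp_group by blast
  interpret I: normal "N \<inter> P" ?S using normal_Int_subgroup[OF P N(1)] .
  interpret Q: group "?S Mod (N \<inter> P)" by (rule I.factorgroup_is_group)
  have "order (?S Mod (N \<inter> P)) * card (N \<inter> P) = p ^ multiplicity p (order G)"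
    using S.lagrange[OF I.subgroup_axioms] cardP by (simp add: order_def FactGroup_def)
  then obtain b where b: "order (?S Mod (N \<inter> P)) = p ^ b"
    using divides_primepow_nat[OF p] by (metis dvd_triv_left)
  obtain y where y: "y \<in> P" "y \<notin> N" using no[OF P cardP] by blast
  \<comment> \<open>With \<open>b = 0\<close> the quotient would be trivial, and \<open>y\<close>
    would lie in \<open>N\<close>.\<close>
  have "b > 0"
  proof (rule ccontr)
    assume "\<not> b > 0"
    then have "card (carrier (?S Mod (N \<inter> P))) = 1" using b by (simp add: order_def)
    then obtain w where w: "carrier (?S Mod (N \<inter> P)) = {w}" by (metis card_1_singletonE)
    have "(N \<inter> P) #>\<^bsub>?S\<^esub> y \<in> carrier (?S Mod (N \<inter> P))"
      using y by (auto simp: FactGroup_def RCOSETS_def)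
    then have "(N \<inter> P) #>\<^bsub>?S\<^esub> y = N \<inter> P" using Q.one_closed w by simp
    then show False using S.coset_join1[OF _ _ I.subgroup_axioms] y by simp
  qed
  then obtain z where z: "z \<in> carrier (?S Mod (N \<inter> P))" "z \<noteq> \<one>\<^bsub>?S Mod (N \<inter> P)\<^esub>"
    and central: "\<And>g. g \<in> carrier (?S Mod (N \<inter> P)) \<Longrightarrow> z \<otimes>\<^bsub>?S Mod (N \<inter> P)\<^esub> g = g \<otimes>\<^bsub>?S Mod (N \<inter> P)\<^esub> z"
    using Q.p_group_center_nontrivial[OF p b] by blast
  obtain x where x: "x \<in> P" "z = (N \<inter> P) #>\<^bsub>?S\<^esub> x"
    using z by (auto simp: FactGroup_def RCOSETS_def)
  have xN: "x \<notin> N"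
    using z x S.coset_join2[OF _ I.subgroup_axioms, of x] by auto
  have xG: "x \<in> carrier G" using x PG by blast
  let ?C = "{g \<in> carrier G. x \<otimes> g \<otimes> inv x \<otimes> inv g \<in> N}"
  have "P \<subseteq> ?C"
  proof
    fix g assume g: "g \<in> P"
    have "(N \<inter> P) #>\<^bsub>?S\<^esub> g \<in> carrier (?S Mod (N \<inter> P))"
      using g by (auto simp: FactGroup_def RCOSETS_def)
    then have "x \<otimes>\<^bsub>?S\<^esub> g \<otimes>\<^bsub>?S\<^esub> inv\<^bsub>?S\<^esub> x \<otimes>\<^bsub>?S\<^esub> inv\<^bsub>?S\<^esub> g \<in> N \<inter> P"
      using I.commutator_mem_iff[of x g] central x g by simp
    then show "g \<in> ?C" using g x PG m_inv_consistent[OF P] by auto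
  qed
  have "?C = carrier G"
  proof (rule subgroup_containing_sylows[OF N.commutator_centralizer_subgroup[OF xG]])
    fix q :: nat assume q: "prime q"
    show "\<exists>P. subgroup P G \<and> P \<subseteq> ?C \<and> card P = q ^ multiplicity q (order G)"
    proof (cases "q = p")
      case True
      then show ?thesis using P cardP \<open>P \<subseteq> ?C\<close> by blast
    next
      case False
      obtain R where R: "subgroup R G" "card R = q ^ multiplicity q (order G)"
        using sylow_subgroup_exists[OF q] .
      have "g \<in> ?C" if g: "g \<in> R" for g
      proof -
        have gG: "g \<in> carrier G" using g R subgroup.subset by blast
        obtain i j where "ord x = p ^ i" "ord g = q ^ j"
          using ord_in_p_subgroup[OF p P cardP x(1)] ord_in_p_subgroup[OF q R g] by blast
        then have "x \<otimes> g = g \<otimes> x"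
          using comm p q False xG gG unfolding prime_powers_commute_def by metis
        then have "x \<otimes> g \<otimes> inv x \<otimes> inv g = \<one>"
          using commutator_eq_one_iff xG gG by blast
        then show ?thesis using gG N.one_closed by simp
      qed
      then show ?thesis using R by blast
    qed
  qed
  then show ?thesis using xG xN by blast
qed

text \<open>The induction climbs from \<open>N\<close> to the preimage \<open>?M\<close> of the
  centre of \<open>G Mod N\<close>, which is strictly larger by \<open>central_mod_normal\<close>.
  Once some term of the series lies in \<open>?M\<close>, the next one lies in
  \<open>N\<close>.\<close>

lemma lower_central_series_subset_normal:
  assumes comm: prime_powers_commute
  shows "N \<lhd> G \<Longrightarrow> \<exists>n. lower_central_series G n \<subseteq> N"
proof (induction "card (carrier G) - card N" arbitrary: N rule: less_induct)
  case less
  then interpret N: normal N G by simp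
  show ?case
  proof (cases "N = carrier G")
    case True
    then show ?thesis using lower_central_series.simps(1)[of G] by blast
  next
    case False
    let ?M = "{x \<in> carrier G. \<forall>g \<in> carrier G. x \<otimes> g \<otimes> inv x \<otimes> inv g \<in> N}"
    obtain x where "x \<in> carrier G" "\<forall>g \<in> carrier G. x \<otimes> g \<otimes> inv x \<otimes> inv g \<in> N" "x \<notin> N"
      using central_mod_normal[OF comm less.prems False] by (elim bexE conjE)
    then have x: "x \<in> ?M" "x \<notin> N" by simp_all
    have "N \<subseteq> ?M"
    proof
      fix a assume a: "a \<in> N"
      then have aG: "a \<in> carrier G" using N.subset by blast
      \<comment> \<open>The commutator is \<open>a\<close> times a conjugate of
        \<open>inv a\<close>.\<close>
      have "a \<otimes> g \<otimes> inv a \<otimes> inv g \<in> N" if g: "g \<in> carrier G" for g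
        using N.m_closed[OF a N.inv_op_closed2[OF g N.m_inv_closed[OF a]]] a aG g by (simp add: m_assoc)
      then show "a \<in> ?M" using aG by blast
    qed
    then have "card N < card ?M" using x fin by (intro psubset_card_mono) auto
    moreover have "card ?M \<le> card (carrier G)" using fin by (intro card_mono) auto
    ultimately have "card (carrier G) - card ?M < card (carrier G) - card N" by linarith
    then obtain n where n: "lower_central_series G n \<subseteq> ?M"
      using less.hyps[OF _ N.central_preimage_normal] by (elim meta_impE exE) assumption
    have "lower_central_series G (Suc n) \<subseteq> N"
      unfolding lower_central_series.simps
      by (rule generate_subgroup_incl[OF _ N.subgroup_axioms]) (use n in blast)
    then show ?thesis by blast
  qed
qed

lemma nilpotent_if_prime_powers_commute:
  assumes prime_powers_commute
  shows "nilpotent G"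
proof -
  obtain n where "lower_central_series G n \<subseteq> {\<one>}"
    using lower_central_series_subset_normal[OF assms one_is_normal] by blast
  moreover have "\<one> \<in> lower_central_series G n"
    using lower_central_series_normal normal_imp_subgroup subgroup.one_closed by blast
  ultimately show ?thesis unfolding nilpotent_def by blast
qed

end

section \<open>From power graphs to comparability\<close>

lemma (in finite_group) comparable_iff_power_graph:
  assumes "a \<in> carrier G" "b \<in> carrier G"
  shows "comparable a b \<longleftrightarrow> a = b \<or> (a, b) \<in> parcs (power_graph G)"
proof -
  have below: "below x y \<longleftrightarrow> (\<exists>m::nat. m > 0 \<and> y [^] m = x)" if y: "y \<in> carrier G" for x y
  proof
    assume "below x y"
    then obtain m :: nat where m: "y [^] m = x" by (auto simp: below_def)
    \<comment> \<open>Adding \<open>ord y\<close> keeps the power and makes the exponent positive,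
      as \<open>power_graph\<close> demands.\<close>
    then have "y [^] (m + ord y) = x"
      using y nat_pow_closed[OF y, of m] by (simp add: nat_pow_mult[symmetric])
    then show "\<exists>m::nat. m > 0 \<and> y [^] m = x" using ord_pos[OF y] by (metis add_gr_0)
  qed (auto simp: below_def)
  have "comparable a a" using assms below_refl by (simp add: comparable_def)
  then show ?thesis using assms by (auto simp: comparable_def below power_graph_def)
qed

theorem corollary3p2:
  fixes G :: "('a, 'm) monoid_scheme" and H :: "('b, 'n) monoid_scheme"
  assumes "group G" and "finite (carrier G)"
    and "group H" and "finite (carrier H)"
    and "digraph_iso (with_proj (power_graph G)) (with_proj (power_graph H))"
    and "nilpotent H"
  shows "nilpotent G"
proof -
  interpret G: finite_group G using assms by (simp add: finite_group_def finite_group_axioms_def)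
  interpret H: finite_group H using assms by (simp add: finite_group_def finite_group_axioms_def)
  obtain f where f: "bij_betw f (carrier G) (carrier H)"
    and adj: "\<And>a b. a \<in> carrier G \<Longrightarrow> b \<in> carrier G \<Longrightarrow>
      (a, b) \<in> parcs (power_graph G) \<longleftrightarrow> (f a, f b) \<in> parcs (power_graph H)"
    using assms(5) by (subst (asm) digraph_iso_with_proj_iff) (auto simp: power_graph_def)
  have f_closed: "f x \<in> carrier H" if "x \<in> carrier G" for x
    using f that by (rule bij_betw_apply)
  have f_surj: "\<exists>x \<in> carrier G. f x = y" if "y \<in> carrier H" for y
    using bij_betw_imp_surj_on[OF f] that by (metis imageE)
  have comparable: "H.comparable (f x) (f y) \<longleftrightarrow> G.comparable x y"
    if "x \<in> carrier G" "y \<in> carrier G" for x y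
  proof -
    have "f x = f y \<longleftrightarrow> x = y" using inj_on_eq_iff[OF bij_betw_imp_inj_on[OF f]] that by blast
    then show ?thesis
      using that f_closed adj G.comparable_iff_power_graph H.comparable_iff_power_graph by simp
  qed
  have "G.prime_powers_commute"
  proof (cases "\<exists>z \<in> carrier G. z \<noteq> \<one>\<^bsub>G\<^esub> \<and> (\<forall>y \<in> carrier G. G.comparable z y)")
    case True
    then show ?thesis using G.prime_powers_commute_if_dominating by blast
  next
    case False
    then have dom: "x = \<one>\<^bsub>G\<^esub>"
      if "x \<in> carrier G" "\<And>y. y \<in> carrier G \<Longrightarrow> G.comparable x y" for x
      using that by blast
    \<comment> \<open>A vertex of \<open>H\<close> comparable with everything pulls back to one of
      \<open>G\<close>, so it is the image of the identity. The identity of \<open>H\<close> is such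
      a vertex; hence \<open>f\<close> preserves the identity and \<open>H\<close> is reduced as
      well.\<close>
    have dom_preimage: "y = f \<one>\<^bsub>G\<^esub>"
      if y: "y \<in> carrier H" "\<And>w. w \<in> carrier H \<Longrightarrow> H.comparable y w" for y
    proof -
      obtain x where x: "x \<in> carrier G" "f x = y" using f_surj y(1) by blast
      then have "G.comparable x w" if "w \<in> carrier G" for w
        using comparable[OF x(1) that] y(2) f_closed that by blast
      then show ?thesis using dom x by blast
    qed
    have "\<one>\<^bsub>H\<^esub> = f \<one>\<^bsub>G\<^esub>"
      using dom_preimage[OF H.one_closed] by (simp add: H.comparable_def H.one_below)
    then interpret comparability_iso G H f
      using dom dom_preimage f comparable by unfold_locales metis+
    show ?thesis
      using prime_powers_commute_transfer H.nilpotent_prime_powers_commute assms(6) by blast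
  qed
  then show ?thesis by (rule G.nilpotent_if_prime_powers_commute)
qed

end
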